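(* Let $(X,d)$ be a complete $b$-metric space with coefficient $s \geq 1$, let $\theta\in X$ be a fixed point of reference (an arbitrary fixed element of $X$), and let $E$ be a nonempty, bounded and closed subset of $X$. For each $i\in\mathbb{N}_0$ let $T_i:X\to X$ be a weak quasi-contraction that is $\mathcal{O}$-$b$ continuous, and suppose that $$\operatorname{diam}\mathcal{O}_{T_j}(T_ix,T_iy)\leq\operatorname{diam}\mathcal{O}_{T_j}(x,y)\quad\text{for all } x,y\in X,\ i,j\in\mathbb{N}_0.$$ Let $\mathfrak{F}$ be a nonempty set of mappings $f:\mathbb{N}_0\to\mathbb{N}_0$ with the shift property: if $f\in\mathfrak{F}$ and $p\in\mathbb{N}$, then $f_p\in\mathfrak{F}$, where $f_p(i)=f(i+p)$ for all $i\in\mathbb{N}_0$. Suppose that: (a) for each $e\in E$ and each $i\in\mathbb{N}_0$ there exists $e'\in E$ such that $T_i(e')=e$; (b) for each $\epsilon,K>0$ there exists a natural number $n_{\epsilon,K}$ such that for each $f\in\mathfrak{F}$ and each $x\in X$ satisfying $\operatorname{diam}\mathcal{O}_{T_i}(x,\theta)\leq\frac{K}{s}$ for all $i\in\mathbb{N}_0$, we have $$d(T_{f(n_{\epsilon,K})}T_{f(n_{\epsilon,K}-1)}\cdots T_{f(1)}T_{f(0)}x,\,E)<\epsilon.$$ Let $\{\delta_i\}_{i=0}^\infty$ be a sequence of positive numbers with $\lim_{i\to\infty}\delta_i=0$. Then for each $\epsilon,K>0$ there exists $\tilde{n}\in\mathbb{N}$ such that for each $f\in\mathfrak{F}$ and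 each sequence $\{x_i\}_{i=0}^\infty\subset X$ satisfying $$\operatorname{diam}\mathcal{O}_{T_j}(x_i,\theta)\leq\frac{K}{s}\quad\text{for all } i,j\in\mathbb{N}_0$$ and $$\operatorname{diam}\mathcal{O}_{T_{f(j)}}(x_{i+1},T_{f(i)}x_i)\leq\delta_i\quad\text{for all } i,j\in\mathbb{N}_0,$$ one has $d(x_i,E)<\epsilon$ for all $i\geq\tilde{n}$.
   Context: $\mathbb{N}$ is the set of natural numbers (positive integers) and $\mathbb{N}_0=\mathbb{N}\cup\{0\}$. A $b$-metric space with coefficient $s\geq1$ is a nonempty set $X$ with $d:X\times X\to[0,\infty)$ such that for all $x,y,z\in X$: $d(x,y)=0$ iff $x=y$; $d(x,y)=d(y,x)$; $d(x,y)\leq s[d(x,z)+d(z,y)]$. A sequence $\{x_n\}$ converges to $x$ iff $d(x_n,x)\to0$; it is Cauchy iff $d(x_n,x_m)\to0$ as $n,m\to\infty$; $(X,d)$ is complete if every Cauchy sequence converges in $X$. For nonempty $A\subset X$, $d(x,A)=\inf\{d(x,y):y\in A\}$. For $T:X\to X$: $T^0$ is the identity, $T^{n+1}=T\circ T^n$, $\mathcal{O}_T(x)=\{T^nx:n\in\mathbb{N}_0\}$, $\mathcal{O}_T(x,y)=\mathcal{O}_T(x)\cup\mathcal{O}_T(y)$; $\operatorname{diam}A=\sup\{d(u,v):u,v\in A\}$. $T$ is a weak quasi-contraction if every orbit $\mathcal{O}_T(x)$ is bounded and $d(Tx,Ty)\leq\psi(\operatorname{diam}\mathcal{O}_T(x,y))$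 for all $x,y\in X$, for some $\psi:[0,\infty)\to[0,\infty)$ that is increasing and upper semi-continuous with $\psi(0)=0$ and $\psi(t)<t$ for all $t>0$. $T$ is $\mathcal{O}$-$b$ continuous if for every sequence $\{x_n\}\subset X$, $x_n\to x$ in $(X,d)$ implies $\operatorname{diam}\mathcal{O}_T(x_n,x)\to0$. *)

theory Defs
  imports Complex_Main "HOL-Library.FuncSet"
begin

locale b_metric_space =
  fixes X :: "'a set" and d :: "'a \<Rightarrow> 'a \<Rightarrow> real" and s :: real
  assumes nonempty: "X \<noteq> {}"
    and coeff_ge_1: "s \<ge> 1"
    and nonneg: "\<And>x y. \<lbrakk>x \<in> X; y \<in> X\<rbrakk> \<Longrightarrow> 0 \<le> d x y"
    and zero_iff: "\<And>x y. \<lbrakk>x \<in> X; y \<in> X\<rbrakk> \<Longrightarrow> d x y = 0 \<longleftrightarrow> x = y"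
    and commute: "\<And>x y. \<lbrakk>x \<in> X; y \<in> X\<rbrakk> \<Longrightarrow> d x y = d y x"
    and triangle: "\<And>x y z. \<lbrakk>x \<in> X; y \<in> X; z \<in> X\<rbrakk> \<Longrightarrow> d x y \<le> s * (d x z + d z y)"

definition b_converges :: "('a \<Rightarrow> 'a \<Rightarrow> real) \<Rightarrow> (nat \<Rightarrow> 'a) \<Rightarrow> 'a \<Rightarrow> bool" where
  "b_converges d x l \<longleftrightarrow> (\<lambda>n. d (x n) l) \<longlonglongrightarrow> 0"

definition b_Cauchy :: "('a \<Rightarrow> 'a \<Rightarrow> real) \<Rightarrow> (nat \<Rightarrow> 'a) \<Rightarrow> bool" where
  "b_Cauchy d x \<longleftrightarrow> (\<forall>\<epsilon>>0. \<exists>N. \<forall>n\<ge>N. \<forall>m\<ge>N. d (x n) (x m) < \<epsilon>)"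

definition b_complete :: "'a set \<Rightarrow> ('a \<Rightarrow> 'a \<Rightarrow> real) \<Rightarrow> bool" where
  "b_complete X d \<longleftrightarrow>
    (\<forall>x. (\<forall>n. x n \<in> X) \<and> b_Cauchy d x \<longrightarrow> (\<exists>l\<in>X. b_converges d x l))"

definition b_bounded :: "('a \<Rightarrow> 'a \<Rightarrow> real) \<Rightarrow> 'a set \<Rightarrow> bool" where
  "b_bounded d A \<longleftrightarrow> (\<exists>M. \<forall>u\<in>A. \<forall>v\<in>A. d u v \<le> M)"

text \<open>Sequential closedness; in a \<open>b\<close>-metric space this agrees with closedness in the topology
  whose open sets are those containing a ball around each of their points (the balls themselves
  need not be open).\<close>

definition b_closed :: "'a set \<Rightarrow> ('a \<Rightarrow> 'a \<Rightarrow> real) \<Rightarrow> 'a set \<Rightarrow> bool" where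
  "b_closed X d A \<longleftrightarrow> A \<subseteq> X \<and>
    (\<forall>x l. (\<forall>n. x n \<in> A) \<and> l \<in> X \<and> b_converges d x l \<longrightarrow> l \<in> A)"

definition b_setdist :: "('a \<Rightarrow> 'a \<Rightarrow> real) \<Rightarrow> 'a \<Rightarrow> 'a set \<Rightarrow> real" where
  "b_setdist d x A = Inf {d x y | y. y \<in> A}"

text \<open>A real supremum, hence meaningful only for nonempty bounded sets. All uses below concern
  unions of two orbits of a map all of whose orbits are bounded.\<close>

definition b_diam :: "('a \<Rightarrow> 'a \<Rightarrow> real) \<Rightarrow> 'a set \<Rightarrow> real" where
  "b_diam d A = Sup {d u v | u v. u \<in> A \<and> v \<in> A}"

definition orbit :: "('a \<Rightarrow> 'a) \<Rightarrow> 'a \<Rightarrow> 'a set" where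
  "orbit T x = {(T ^^ n) x | n. True}"

definition orbit2 :: "('a \<Rightarrow> 'a) \<Rightarrow> 'a \<Rightarrow> 'a \<Rightarrow> 'a set" where
  "orbit2 T x y = orbit T x \<union> orbit T y"

definition upper_semicontinuous_on :: "real set \<Rightarrow> (real \<Rightarrow> real) \<Rightarrow> bool" where
  "upper_semicontinuous_on S \<psi> \<longleftrightarrow>
    (\<forall>t\<in>S. \<forall>c>\<psi> t. \<forall>\<^sub>F u in at t within S. \<psi> u < c)"

definition weak_quasi_contraction :: "'a set \<Rightarrow> ('a \<Rightarrow> 'a \<Rightarrow> real) \<Rightarrow> ('a \<Rightarrow> 'a) \<Rightarrow> bool" where
  "weak_quasi_contraction X d T \<longleftrightarrow>
    T \<in> X \<rightarrow> X \<and>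
    (\<forall>x\<in>X. b_bounded d (orbit T x)) \<and>
    (\<exists>\<psi>. \<psi> \<in> {0..} \<rightarrow> {0..} \<and> mono_on {0..} \<psi> \<and> upper_semicontinuous_on {0..} \<psi> \<and>
         \<psi> 0 = 0 \<and> (\<forall>t>0. \<psi> t < t) \<and>
         (\<forall>x\<in>X. \<forall>y\<in>X. d (T x) (T y) \<le> \<psi> (b_diam d (orbit2 T x y))))"

definition O_b_continuous :: "'a set \<Rightarrow> ('a \<Rightarrow> 'a \<Rightarrow> real) \<Rightarrow> ('a \<Rightarrow> 'a) \<Rightarrow> bool" where
  "O_b_continuous X d T \<longleftrightarrow>
    (\<forall>x l. (\<forall>n. x n \<in> X) \<and> l \<in> X \<and> b_converges d x l \<longrightarrow>
       (\<lambda>n. b_diam d (orbit2 T (x n) l)) \<longlonglongrightarrow> 0)"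

text \<open>\<open>iter_comp T f n x\<close> is \<open>T\<^bsub>f n\<^esub> (\<dots> (T\<^bsub>f 1\<^esub> (T\<^bsub>f 0\<^esub> x)))\<close>, a product of \<open>n + 1\<close> maps.\<close>

primrec iter_comp :: "(nat \<Rightarrow> 'a \<Rightarrow> 'a) \<Rightarrow> (nat \<Rightarrow> nat) \<Rightarrow> nat \<Rightarrow> 'a \<Rightarrow> 'a" where
  "iter_comp T f 0 x = T (f 0) x"
| "iter_comp T f (Suc n) x = T (f (Suc n)) (iter_comp T f n x)"

end

theory Submission
  imports Defs
begin

text \<open>Unroll the inexact orbit over a block of \<open>n + 1\<close> steps, with \<open>n\<close> given by (b). Measured by the
  diameter of joint orbits of one fixed map, the exact trajectory started at \<open>x\<^sub>k\<close> differs
  from the inexact one by at most \<open>\<delta>\<^sub>k\<close> after one step, and every further step maps an error bound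
  \<open>D\<close> to \<open>s (\<delta> + D)\<close>, since the maps do not expand these diameters. Hence the error after the
  block is at most a constant depending only on \<open>s\<close> and \<open>n\<close> times the supremum of the tail of
  \<open>\<delta>\<close>.\<close>

lemma orbit_subset:
  assumes "T \<in> X \<rightarrow> X" "x \<in> X"
  shows "orbit T x \<subseteq> X"
proof -
  have "(T ^^ n) x \<in> X" for n
    using assms by (induction n) auto
  then show ?thesis by (auto simp: orbit_def)
qed

lemma self_in_orbit: "x \<in> orbit T x"
  unfolding orbit_def by (rule CollectI, rule exI[of _ 0]) simp

lemma dist_le_b_diam:
  assumes "b_bounded d A" "u \<in> A" "v \<in> A"
  shows "d u v \<le> b_diam d A"
proof -
  obtain M where "\<forall>u\<in>A. \<forall>v\<in>A. d u v \<le> M"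
    using assms(1) unfolding b_bounded_def by blast
  then have "bdd_above {d u v | u v. u \<in> A \<and> v \<in> A}"
    by (intro bdd_aboveI[of _ M]) auto
  then show ?thesis
    unfolding b_diam_def using assms(2,3) by (intro cSup_upper) auto
qed

lemma b_diam_le:
  assumes "A \<noteq> {}" "\<And>u v. u \<in> A \<Longrightarrow> v \<in> A \<Longrightarrow> d u v \<le> c"
  shows "b_diam d A \<le> c"
  unfolding b_diam_def using assms by (intro cSup_least) blast+

context b_metric_space
begin

lemma b_bounded_Un:
  assumes "A \<subseteq> X" "B \<subseteq> X" "b_bounded d A" "b_bounded d B"
  shows "b_bounded d (A \<union> B)"
proof (cases "A = {} \<or> B = {}")
  case True
  then show ?thesis using assms(3,4) by auto
next
  case False
  then obtain a b where ab: "a \<in> A" "b \<in> B" by blast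
  obtain M where M: "\<And>u v. u \<in> A \<Longrightarrow> v \<in> A \<Longrightarrow> d u v \<le> M"
    using assms(3) unfolding b_bounded_def by blast
  obtain N where N: "\<And>u v. u \<in> B \<Longrightarrow> v \<in> B \<Longrightarrow> d u v \<le> N"
    using assms(4) unfolding b_bounded_def by blast
  \<comment> \<open>\<open>C\<close> comes from the chain from \<open>u\<close> through
    \<open>a\<close> and \<open>b\<close> to \<open>v\<close>: each of the two applications of the
    relaxed triangle inequality costs a factor \<open>s\<close>.\<close>
  define C where "C = s * (M + s * (d a b + N))"
  have cross: "d u v \<le> C" if "u \<in> A" "v \<in> B" for u v
  proof -
    have X: "u \<in> X" "v \<in> X" "a \<in> X" "b \<in> X" using that ab assms(1,2) by auto
    have "d a v \<le> s * (d a b + d b v)" using triangle X by blast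
    also have "\<dots> \<le> s * (d a b + N)"
      using N[OF ab(2) that(2)] coeff_ge_1 by (intro mult_left_mono) auto
    finally have av: "d a v \<le> s * (d a b + N)" .
    have "d u v \<le> s * (d u a + d a v)" using triangle X by blast
    also have "\<dots> \<le> C"
      unfolding C_def using M[OF that(1) ab(1)] av coeff_ge_1 by (intro mult_left_mono) auto
    finally show ?thesis .
  qed
  have "d u v \<le> max (max M N) C" if "u \<in> A \<union> B" "v \<in> A \<union> B" for u v
  proof -
    have "d u v = d v u" using commute that assms(1,2) by blast
    then show ?thesis
      using that M[of u v] N[of u v] cross[of u v] cross[of v u] by fastforce
  qed
  then show ?thesis unfolding b_bounded_def by blast
qed

lemma orbit2_subset:
  assumes "weak_quasi_contraction X d T" "x \<in> X" "y \<in> X"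
  shows "orbit2 T x y \<subseteq> X"
  using assms orbit_subset[of T X] unfolding orbit2_def weak_quasi_contraction_def by simp

lemma b_bounded_orbit2:
  assumes "weak_quasi_contraction X d T" "x \<in> X" "y \<in> X"
  shows "b_bounded d (orbit2 T x y)"
  using assms orbit_subset[of T X] b_bounded_Un
  unfolding orbit2_def weak_quasi_contraction_def by simp

text \<open>Turns estimates on orbit diameters back into estimates on distances: iterate 0 puts both
  points in their own orbits.\<close>

lemma dist_le_b_diam_orbit2:
  assumes "weak_quasi_contraction X d T" "x \<in> X" "y \<in> X"
  shows "d x y \<le> b_diam d (orbit2 T x y)"
  using dist_le_b_diam[OF b_bounded_orbit2[OF assms]]
  by (simp add: orbit2_def self_in_orbit)

text \<open>Only pairs with one point in \<open>A\<close> and the other in \<open>B\<close> need a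
  detour, through an arbitrary point of \<open>C\<close>. Pairs inside \<open>A\<close> or inside
  \<open>B\<close> are already controlled by one of the two diameters on the right.\<close>

lemma b_diam_Un_triangle:
  assumes "A \<union> C \<subseteq> X" "C \<union> B \<subseteq> X" "b_bounded d (A \<union> C)" "b_bounded d (C \<union> B)"
    and "A \<union> B \<noteq> {}" "C \<noteq> {}"
  shows "b_diam d (A \<union> B) \<le> s * (b_diam d (A \<union> C) + b_diam d (C \<union> B))"
    (is "_ \<le> s * (?AC + ?CB)")
proof (rule b_diam_le)
  obtain c where c: "c \<in> C" using assms(6) by blast
  have AC: "d u v \<le> ?AC" if "u \<in> A \<union> C" "v \<in> A \<union> C" for u v
    using dist_le_b_diam[OF assms(3) that] .
  have CB: "d u v \<le> ?CB" if "u \<in> C \<union> B" "v \<in> C \<union> B" for u v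
    using dist_le_b_diam[OF assms(4) that] .
  have cX: "c \<in> X" using c assms(1) by auto
  have nn: "0 \<le> ?AC" "0 \<le> ?CB"
    using AC[of c c] CB[of c c] c nonneg[OF cX cX] by auto
  \<comment> \<open>As \<open>s\<close> is at least 1 and both diameters are nonnegative, the cross
    bound also absorbs the pairs inside one set.\<close>
  then have sum: "?AC + ?CB \<le> s * (?AC + ?CB)"
    using coeff_ge_1 mult_right_mono[of 1 s "?AC + ?CB"] by simp
  have cross: "d u v \<le> s * (?AC + ?CB)" if "u \<in> A" "v \<in> B" for u v
  proof -
    have "d u v \<le> s * (d u c + d c v)"
      using triangle that c assms(1,2) by blast
    also have "\<dots> \<le> s * (?AC + ?CB)"
      using AC[of u c] CB[of c v] that c coeff_ge_1 by (intro mult_left_mono) auto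
    finally show ?thesis .
  qed
  show "d u v \<le> s * (?AC + ?CB)" if "u \<in> A \<union> B" "v \<in> A \<union> B" for u v
  proof -
    consider "u \<in> A" "v \<in> A" | "u \<in> B" "v \<in> B" | "u \<in> A" "v \<in> B" | "u \<in> B" "v \<in> A"
      using \<open>u \<in> A \<union> B\<close> \<open>v \<in> A \<union> B\<close> by blast
    then show ?thesis
    proof cases
      case 1
      then show ?thesis using AC[of u v] nn sum by simp
    next
      case 2
      then show ?thesis using CB[of u v] nn sum by simp
    next
      case 3
      then show ?thesis by (rule cross)
    next
      case 4
      then have "d u v = d v u" using commute assms(1,2) by blast
      then show ?thesis using cross[OF 4(2,1)] by simp
    qed
  qed
qed (use assms(5) in simp)

lemma b_diam_orbit2_triangle:
  assumes "weak_quasi_contraction X d T" "x \<in> X" "y \<in> X" "z \<in> X"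
  shows "b_diam d (orbit2 T x y) \<le> s * (b_diam d (orbit2 T x z) + b_diam d (orbit2 T z y))"
  using orbit2_subset[OF assms(1), of x z] orbit2_subset[OF assms(1), of z y]
    b_bounded_orbit2[OF assms(1), of x z] b_bounded_orbit2[OF assms(1), of z y]
    self_in_orbit[of x T] self_in_orbit[of z T] assms
  unfolding orbit2_def by (intro b_diam_Un_triangle) auto

text \<open>The infimum need not be attained, but the strict bound \<open>b\<close> yields a point
  \<open>e\<close> of \<open>E\<close> with \<open>d y e < b\<close>, and the path from
  \<open>x\<close> to \<open>e\<close> runs through \<open>y\<close>.\<close>

lemma b_setdist_less_triangle:
  assumes "E \<subseteq> X" "E \<noteq> {}" "x \<in> X" "y \<in> X" "d x y \<le> a" "b_setdist d y E < b"
  shows "b_setdist d x E < s * (a + b)"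
proof -
  obtain e where e: "e \<in> E" "d y e < b"
    using cInf_lessD[of "{d y e | e. e \<in> E}" b] assms(2,6) unfolding b_setdist_def by auto
  have "bdd_below {d x e | e. e \<in> E}"
    using nonneg assms(1,3) by (intro bdd_belowI[of _ 0]) auto
  then have "b_setdist d x E \<le> d x e"
    unfolding b_setdist_def using e(1) by (intro cInf_lower) auto
  also have "\<dots> \<le> s * (d x y + d y e)" using triangle assms e by blast
  also have "\<dots> < s * (a + b)"
    using assms(5) e(2) coeff_ge_1 by (intro mult_strict_left_mono) auto
  finally show ?thesis .
qed

end

lemma iter_comp_in:
  assumes "\<And>i. T i \<in> X \<rightarrow> X" "x \<in> X"
  shows "iter_comp T f n x \<in> X"
  using assms by (induction n) (auto simp: Pi_iff)

text \<open>Solves the error recursion: with one-step error \<eta>, the bounds D(0) = \<eta> and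
  D(m+1) = s (\<eta> + D(m)) give D(m) = \<open>error_factor s m\<close> * \<eta>.\<close>

primrec error_factor :: "real \<Rightarrow> nat \<Rightarrow> real" where
  "error_factor s 0 = 1"
| "error_factor s (Suc n) = s * (1 + error_factor s n)"

lemma error_factor_pos: "s \<ge> 1 \<Longrightarrow> error_factor s n > 0"
  by (induction n) (auto intro!: mult_pos_pos)

text \<open>The index \<open>j\<close> of the measuring map stays fixed while the maps
  \<open>T (g i)\<close> vary, so nonexpansion carries the same quantity from step to step.\<close>

lemma (in b_metric_space) b_diam_inexact_orbit:
  assumes wqc: "\<And>i. weak_quasi_contraction X d (T i)"
    and nonexp: "\<And>x y i. x \<in> X \<Longrightarrow> y \<in> X \<Longrightarrow>
           b_diam d (orbit2 (T j) (T i x) (T i y)) \<le> b_diam d (orbit2 (T j) x y)"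
    and xX: "\<And>i. x i \<in> X"
    and err: "\<And>i. b_diam d (orbit2 (T j) (x (Suc i)) (T (g i) (x i))) \<le> \<eta>"
  shows "b_diam d (orbit2 (T j) (x (Suc m)) (iter_comp T g m (x 0))) \<le> error_factor s m * \<eta>"
proof (induction m)
  case 0
  then show ?case using err[of 0] by simp
next
  case (Suc m)
  \<comment> \<open>\<open>?z\<close> is the intermediate point: the exact map applied to the
    inexact point. Its gap to the next inexact point is one new error; its gap to the next exact
    point is the old error, not enlarged by the map.\<close>
  let ?y = "iter_comp T g m (x 0)" and ?z = "T (g (Suc m)) (x (Suc m))"
  have TX: "T i \<in> X \<rightarrow> X" for i using wqc unfolding weak_quasi_contraction_def by blast
  have yX: "?y \<in> X" using iter_comp_in[of T X "x 0" g m] TX xX by blast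
  have zX: "?z \<in> X" and TyX: "T (g (Suc m)) ?y \<in> X" using TX xX yX by (auto simp: Pi_iff)
  have "b_diam d (orbit2 (T j) ?z (T (g (Suc m)) ?y)) \<le> error_factor s m * \<eta>"
    using nonexp[OF xX[of "Suc m"] yX, of "g (Suc m)"] Suc.IH by simp
  then have "b_diam d (orbit2 (T j) (x (Suc (Suc m))) ?z)
      + b_diam d (orbit2 (T j) ?z (T (g (Suc m)) ?y)) \<le> \<eta> + error_factor s m * \<eta>"
    using err[of "Suc m"] by simp
  from mult_left_mono[OF this, of s]
  show ?case
    using b_diam_orbit2_triangle[OF wqc[of j] xX[of "Suc (Suc m)"] TyX zX] coeff_ge_1
    by (simp add: algebra_simps)
qed

theorem theorem2p8:
  fixes X E :: "'a set" and d :: "'a \<Rightarrow> 'a \<Rightarrow> real" and s :: real and \<theta> :: 'a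
    and T :: "nat \<Rightarrow> 'a \<Rightarrow> 'a" and F :: "(nat \<Rightarrow> nat) set" and \<delta> :: "nat \<Rightarrow> real"
  assumes "b_metric_space X d s"
    and "b_complete X d"
    and "\<theta> \<in> X"
    and "E \<noteq> {}" and "E \<subseteq> X" and "b_bounded d E" and "b_closed X d E"
    and "\<And>i. weak_quasi_contraction X d (T i)"
    and "\<And>i. O_b_continuous X d (T i)"
    and "\<And>x y i j. x \<in> X \<Longrightarrow> y \<in> X \<Longrightarrow>
           b_diam d (orbit2 (T j) (T i x) (T i y)) \<le> b_diam d (orbit2 (T j) x y)"
    and "F \<noteq> {}"
    and "\<And>f p. f \<in> F \<Longrightarrow> p \<ge> 1 \<Longrightarrow> (\<lambda>i. f (i + p)) \<in> F"
    and "\<And>e i. e \<in> E \<Longrightarrow> \<exists>e'\<in>E. T i e' = e"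
    and "\<And>\<epsilon> K. \<epsilon> > 0 \<Longrightarrow> K > 0 \<Longrightarrow>
           \<exists>n\<ge>1. \<forall>f\<in>F. \<forall>x\<in>X. (\<forall>i. b_diam d (orbit2 (T i) x \<theta>) \<le> K / s) \<longrightarrow>
             b_setdist d (iter_comp T f n x) E < \<epsilon>"
    and "\<And>i. \<delta> i > 0"
    and "\<delta> \<longlonglongrightarrow> 0"
  shows "\<forall>\<epsilon>>0. \<forall>K>0. \<exists>N\<ge>1. \<forall>f\<in>F. \<forall>x :: nat \<Rightarrow> 'a.
           (\<forall>i. x i \<in> X) \<and>
           (\<forall>i j. b_diam d (orbit2 (T j) (x i) \<theta>) \<le> K / s) \<and>
           (\<forall>i j. b_diam d (orbit2 (T (f j)) (x (Suc i)) (T (f i) (x i))) \<le> \<delta> i) \<longrightarrow>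
           (\<forall>i\<ge>N. b_setdist d (x i) E < \<epsilon>)"
proof (intro allI impI)
  fix \<epsilon> K :: real
  assume "\<epsilon> > 0" and "K > 0"
  interpret b_metric_space X d s by fact
  note wqc = assms(8) and nonexp = assms(10) and shift = assms(12)
  have s: "s > 0" using coeff_ge_1 by simp
  \<comment> \<open>Two contributions of this size, from the accumulated error and from (b), add up
    to \<epsilon> after the factor \<open>s\<close> of the last triangle inequality.\<close>
  then have "\<epsilon> / (2 * s) > 0" using \<open>\<epsilon> > 0\<close> by simp
  then obtain n where n: "\<And>f x. f \<in> F \<Longrightarrow> x \<in> X \<Longrightarrow>
      (\<forall>i. b_diam d (orbit2 (T i) x \<theta>) \<le> K / s) \<Longrightarrow>
      b_setdist d (iter_comp T f n x) E < \<epsilon> / (2 * s)"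
    using assms(14)[OF _ \<open>K > 0\<close>] by meson
  \<comment> \<open>Chosen so that the error accumulated over a block of \<open>n + 1\<close> steps
    is at most \<epsilon> / (2 s).\<close>
  define \<eta> where "\<eta> = \<epsilon> / (2 * s) / error_factor s n"
  have fpos: "error_factor s n > 0" using error_factor_pos coeff_ge_1 by simp
  then have "\<eta> > 0" unfolding \<eta>_def using s \<open>\<epsilon> > 0\<close> by simp
  then obtain M where M: "\<And>i. i \<ge> M \<Longrightarrow> \<delta> i < \<eta>"
    using order_tendstoD(2)[OF assms(16)] unfolding eventually_sequentially by blast
  \<comment> \<open>\<open>n\<close> and \<open>M\<close> were fixed before \<open>f\<close> and
    \<open>x\<close>, so the witness \<open>M + n + 2\<close> is uniform. A block of
    \<open>n + 1\<close> steps ending at \<open>i\<close> then starts at an index of at least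
    \<open>M + 1\<close>; the extra 1 makes the shift positive, as the shift property
    demands.\<close>
  show "\<exists>N\<ge>1. \<forall>f\<in>F. \<forall>x :: nat \<Rightarrow> 'a.
           (\<forall>i. x i \<in> X) \<and>
           (\<forall>i j. b_diam d (orbit2 (T j) (x i) \<theta>) \<le> K / s) \<and>
           (\<forall>i j. b_diam d (orbit2 (T (f j)) (x (Suc i)) (T (f i) (x i))) \<le> \<delta> i) \<longrightarrow>
           (\<forall>i\<ge>N. b_setdist d (x i) E < \<epsilon>)"
  proof (intro exI[of _ "M + n + 2"] conjI ballI allI impI)
    fix f and x :: "nat \<Rightarrow> 'a" and i
    assume f: "f \<in> F" and i: "i \<ge> M + n + 2"
      and x: "(\<forall>i. x i \<in> X) \<and>
           (\<forall>i j. b_diam d (orbit2 (T j) (x i) \<theta>) \<le> K / s) \<and>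
           (\<forall>i j. b_diam d (orbit2 (T (f j)) (x (Suc i)) (T (f i) (x i))) \<le> \<delta> i)"
    define k where "k = i - (n + 1)"
    have k: "k \<ge> 1" "k \<ge> M" "i = Suc n + k" using i by (auto simp: k_def)
    define g where "g = (\<lambda>i. f (i + k))"
    define y where "y = iter_comp T g n (x k)"
    have "T j \<in> X \<rightarrow> X" for j using wqc unfolding weak_quasi_contraction_def by blast
    then have yX: "y \<in> X" unfolding y_def using x by (intro iter_comp_in) auto
    have "g \<in> F" unfolding g_def using shift f k(1) by blast
    then have yE: "b_setdist d y E < \<epsilon> / (2 * s)" unfolding y_def using n x by blast
    \<comment> \<open>The errors are controlled only for measuring maps of the form
      \<open>T (f j)\<close>; \<open>f 0\<close> is one admissible choice, kept throughout the
      block.\<close>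
    have "b_diam d (orbit2 (T (f 0)) (x (Suc m + k)) (T (g m) (x (m + k)))) \<le> \<eta>" for m
    proof -
      have "b_diam d (orbit2 (T (f 0)) (x (Suc m + k)) (T (g m) (x (m + k)))) \<le> \<delta> (m + k)"
        using x unfolding g_def by simp
      then show ?thesis using M[of "m + k"] k(2) by linarith
    qed
    then have "b_diam d (orbit2 (T (f 0)) (x (Suc n + k)) (iter_comp T g n (x (0 + k))))
        \<le> error_factor s n * \<eta>"
      using x nonexp by (intro b_diam_inexact_orbit[OF wqc, where x = "\<lambda>m. x (m + k)"]) auto
    also have "\<dots> = \<epsilon> / (2 * s)" using fpos by (simp add: \<eta>_def)
    finally have "b_diam d (orbit2 (T (f 0)) (x i) y) \<le> \<epsilon> / (2 * s)"
      by (simp add: k(3) y_def)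
    then have "d (x i) y \<le> \<epsilon> / (2 * s)"
      using dist_le_b_diam_orbit2[OF wqc[of "f 0"], of "x i" y] x yX by force
    then have "b_setdist d (x i) E < s * (\<epsilon> / (2 * s) + \<epsilon> / (2 * s))"
      using b_setdist_less_triangle assms(4,5) x yX yE by blast
    also have "\<dots> = \<epsilon>" using s by (simp add: field_simps)
    finally show "b_setdist d (x i) E < \<epsilon>" .
  qed simp
qed

end
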